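(* Let $S$ be an Artinian bounded semilattice with more than two elements. Then $G(S)$ is a complete graph if and only if $|\mathrm{Atom}(S)|=1$.
   Context: A bounded semilattice $(S,\cdot,0,1)$ is a commutative semigroup whose operation is idempotent ($x\cdot x=x$ for all $x$), with a neutral element $1$ and an absorbing element $0$; it is partially ordered by $x\le y \iff x\cdot y=x$, so that $0\le x\le 1$. The graph $G(S)$ is the simple graph with vertex set $S\setminus\{0,1\}$ in which two vertices $x,y$ are adjacent iff $x\ne y$ and $x\cdot y\neq 0$. An atom of $S$ is an element $a$ with $0<a<1$ such that $0\le y\le a$ implies $y=0$ or $y=a$; $\mathrm{Atom}(S)$ is the set of atoms. $S$ is Artinian if every decreasing chain $s_1\ge s_2\ge\cdots$ in $S$ is stationary, i.e. there is $n$ with $s_i=s_{i+1}$ for all $i\ge n$. *)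

theory Defs
  imports "Graph_Theory.Pair_Digraph"
begin

text \<open>
  The underlying set of a bounded semilattice is the whole type \<open>'a\<close>. No distinctness of
  \<open>zero\<close> and \<open>one\<close> is required.
\<close>

locale bounded_semilattice = semilattice_neutr f one
  for f :: "'a \<Rightarrow> 'a \<Rightarrow> 'a"  (infixl \<open>\<^bold>*\<close> 70)
    and one :: 'a  (\<open>\<^bold>1\<close>) +
  fixes zero :: 'a  (\<open>\<^bold>0\<close>)
  assumes absorbing: "\<^bold>0 \<^bold>* x = \<^bold>0"
begin

definition le :: "'a \<Rightarrow> 'a \<Rightarrow> bool"  (infix \<open>\<^bold>\<le>\<close> 50)
  where "x \<^bold>\<le> y \<longleftrightarrow> x \<^bold>* y = x"

definition lt :: "'a \<Rightarrow> 'a \<Rightarrow> bool"  (infix \<open>\<^bold><\<close> 50)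
  where "x \<^bold>< y \<longleftrightarrow> x \<^bold>\<le> y \<and> x \<noteq> y"

sublocale semilattice_neutr_order f one le lt
  by standard (auto simp: le_def lt_def)

lemma zero_le: "\<^bold>0 \<^bold>\<le> x"
  by (simp add: le_def absorbing)

definition Atom :: "'a set"
  where "Atom = {a. \<^bold>0 \<^bold>< a \<and> a \<^bold>< \<^bold>1 \<and> (\<forall>y. \<^bold>0 \<^bold>\<le> y \<and> y \<^bold>\<le> a \<longrightarrow> y = \<^bold>0 \<or> y = a)}"

definition Artinian :: bool
  where "Artinian \<longleftrightarrow>
    (\<forall>s :: nat \<Rightarrow> 'a. (\<forall>i. s (Suc i) \<^bold>\<le> s i) \<longrightarrow> (\<exists>n. \<forall>i\<ge>n. s i = s (Suc i)))"

text \<open>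
  A simple graph, possibly infinite, is a symmetric loop-free pair digraph: an edge joining
  \<open>x\<close> and \<open>y\<close> is the pair of arcs \<open>(x, y)\<close>, \<open>(y, x)\<close>.
\<close>

definition G :: "'a pair_pre_digraph"
  where "G = \<lparr> pverts = UNIV - {\<^bold>0, \<^bold>1},
    parcs = {(x, y). x \<in> UNIV - {\<^bold>0, \<^bold>1} \<and> y \<in> UNIV - {\<^bold>0, \<^bold>1} \<and> x \<noteq> y \<and> x \<^bold>* y \<noteq> \<^bold>0} \<rparr>"

lemma simple_graph_G: "pair_bidirected_digraph G"
  by unfold_locales (auto simp: G_def commute symmetric_def sym_def arcs_ends_def arc_to_ends_def)

end

text \<open>
  The complete digraphs of the library are finite with a prescribed number of vertices; this is
  the same condition on the arcs without finiteness.
\<close>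

definition complete_graph :: "'a pair_pre_digraph \<Rightarrow> bool"
  where "complete_graph H \<longleftrightarrow> pair_bidirected_digraph H \<and>
    parcs H = {(u, v). (u, v) \<in> pverts H \<times> pverts H \<and> u \<noteq> v}"

end

theory Submission
  imports Defs
begin

context bounded_semilattice
begin

text \<open>Completeness of \<open>G\<close> says that distinct vertices never multiply to zero
  (\<open>complete_graph_G_iff\<close>). Distinct atoms do multiply to zero
  (\<open>mult_Atom_Atom\<close>), so completeness allows at most one atom; the Artinian condition
  puts an atom below every vertex (\<open>ex_Atom_le\<close>), and a vertex exists. Conversely, a
  sole atom lies below all vertices, hence below all their products, which are therefore
  nonzero.\<close>

lemma le_zero_iff: "x \<^bold>\<le> \<^bold>0 \<longleftrightarrow> x = \<^bold>0"
  using zero_le antisym by blast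

text \<open>An infinite strictly descending sequence would be a decreasing chain that never becomes
  stationary.\<close>

lemma wfP_lt:
  assumes Artinian
  shows "wfP lt"
proof -
  have "\<nexists>s. \<forall>i. s (Suc i) \<^bold>< s i"
    using assms unfolding Artinian_def lt_def by (metis order_refl)
  then show ?thesis
    by (simp add: wfp_def wf_iff_no_infinite_down_chain)
qed

lemma ex_Atom_le:
  assumes Artinian "x \<noteq> \<^bold>0" "x \<noteq> \<^bold>1"
  obtains a where "a \<in> Atom" "a \<^bold>\<le> x"
proof -
  obtain a where a: "a \<noteq> \<^bold>0" "a \<^bold>\<le> x"
    and min: "\<And>y. y \<^bold>< a \<Longrightarrow> \<not> (y \<noteq> \<^bold>0 \<and> y \<^bold>\<le> x)"
    using wfp_on_iff_ex_minimal[THEN iffD1, OF wfP_lt[OF assms(1)], rule_format,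
        of "{y. y \<noteq> \<^bold>0 \<and> y \<^bold>\<le> x}"] assms(2) refl[of x] by blast
  have "y = \<^bold>0 \<or> y = a" if "y \<^bold>\<le> a" for y
    using min[of y] that trans[OF that a(2)] unfolding lt_def by blast
  moreover have "a \<noteq> \<^bold>1"
    using a(2) assms(3) by (auto simp: le_def)
  ultimately have "a \<in> Atom"
    using a(1) zero_le[of a] le_def[of a "\<^bold>1"] right_neutral[of a] unfolding Atom_def lt_def by simp
  then show ?thesis
    using a(2) that by blast
qed

text \<open>The product lies below both atoms, so if nonzero it would equal each of them.\<close>

lemma mult_Atom_Atom:
  assumes "a \<in> Atom" "b \<in> Atom" "a \<noteq> b"
  shows "a \<^bold>* b = \<^bold>0"
proof (rule ccontr)
  assume "a \<^bold>* b \<noteq> \<^bold>0"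
  then have "a \<^bold>* b = a" "a \<^bold>* b = b"
    using assms(1,2) zero_le[of "a \<^bold>* b"] cobounded1[of a b] cobounded2[of a b]
    unfolding Atom_def by blast+
  then show False
    using assms(3) by simp
qed

lemma complete_graph_G_iff:
  "complete_graph G \<longleftrightarrow>
    (\<forall>x y. x \<notin> {\<^bold>0, \<^bold>1} \<longrightarrow> y \<notin> {\<^bold>0, \<^bold>1} \<longrightarrow> x \<noteq> y \<longrightarrow> x \<^bold>* y \<noteq> \<^bold>0)"
  using simple_graph_G unfolding complete_graph_def by (simp add: G_def set_eq_iff) blast

lemma complete_graph_G_iff_card_Atom:
  assumes Artinian "v \<noteq> \<^bold>0" "v \<noteq> \<^bold>1"
  shows "complete_graph G \<longleftrightarrow> card Atom = 1"
proof
  assume complete: "complete_graph G"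
  obtain a where a: "a \<in> Atom"
    using ex_Atom_le[OF assms] by blast
  have "b = a" if "b \<in> Atom" for b
    using complete mult_Atom_Atom[OF that a] that a
    unfolding complete_graph_G_iff by (auto simp: Atom_def lt_def)
  then have "Atom = {a}"
    using a by blast
  then show "card Atom = 1"
    by simp
next
  assume "card Atom = 1"
  then obtain a where a: "Atom = {a}"
    by (auto simp: card_1_singleton_iff)
  then have "a \<in> Atom"
    by simp
  then have "a \<noteq> \<^bold>0"
    by (auto simp: Atom_def lt_def)
  moreover have below: "a \<^bold>\<le> x" if "x \<noteq> \<^bold>0" "x \<noteq> \<^bold>1" for x
    by (rule ex_Atom_le[OF assms(1) that]) (simp add: a)
  ultimately have "x \<^bold>* y \<noteq> \<^bold>0" if "x \<notin> {\<^bold>0, \<^bold>1}" "y \<notin> {\<^bold>0, \<^bold>1}" for x y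
    using that boundedI[OF below below, of x y] le_zero_iff[of a] by auto
  then show "complete_graph G"
    unfolding complete_graph_G_iff by blast
qed

end

theorem corollary2p15:
  fixes mult :: "'a \<Rightarrow> 'a \<Rightarrow> 'a" and one zero :: 'a
  assumes "bounded_semilattice mult one zero"
    and "bounded_semilattice.Artinian mult"
    and "infinite (UNIV :: 'a set) \<or> card (UNIV :: 'a set) > 2"
  shows "complete_graph (bounded_semilattice.G mult one zero) \<longleftrightarrow>
    card (bounded_semilattice.Atom mult one zero) = 1"
proof -
  \<comment> \<open>The set \<open>{zero, one}\<close> is finite with at most two elements, so the
    size hypothesis leaves a vertex \<open>v\<close> outside it.\<close>
  have "\<not> UNIV \<subseteq> {zero, one}"
    using assms(3) card_mono[of "{zero, one}" UNIV] finite_subset[of UNIV "{zero, one}"]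
      card_insert_le_m1[of 2 "{one}" zero] by auto
  then obtain v where "v \<noteq> zero" "v \<noteq> one"
    by blast
  then show ?thesis
    by (rule bounded_semilattice.complete_graph_G_iff_card_Atom[OF assms(1,2)])
qed

end
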